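(* Let $d \ge 0$ and $p \ge 1$ be integers and let $h$ be a vertex of $S_1$. If there exists an index $i$ (with $0 \le i < i+1 \le p(d+1)-1$) such that $h_i > h_{i+1}$ and $h_i, h_{i+1} \notin \mathbb{Z}$, then $h \notin C_{\mathrm{END}}$.
   Context: A vector $h \in \mathbb{R}^{p(d+1)}$ is indexed as $h = (h_0, h_1, \dots, h_{p(d+1)-1})$, and we write $h_{r,j} := h_{jp+r}$ for $0 \le r \le p-1$ and $0 \le j \le d$. Put $h(z) := \sum_i h_i z^i$ and define $L_h : \mathbb{Z}_{\ge 0} \to \mathbb{R}$ by $\sum_{n \ge 0} L_h(n) z^n := h(z)/(1-z^p)^{d+1}$; equivalently, $L_h(tp+r) = \sum_{j=0}^d h_{r,j}\binom{t+d-j}{d}$ for $t \ge 0$, $0 \le r \le p-1$. For $N \in \mathbb{Z}_{\ge 0}$, let $C_N := \{h \in \mathbb{R}^{p(d+1)} : L_h(n+1) \ge L_h(n) \text{ for all integers } n \ge N\}$, let $C_{\mathrm{END}} := \bigcup_{N \ge 0} C_N$, and let $\overline{C_{\mathrm{END}}}$ be its topological closure. Define the rational polytope $$S_1 := \overline{C_{\mathrm{END}}} \cap \Big\{h \in \mathbb{R}_{\ge 0}^{p(d+1)} : \sum_{j=0}^d h_{0,j} = 1\Big\}.$$ *)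

theory Defs
  imports
    "HOL-Analysis.Analysis"
    "HOL-Library.Function_Algebras"
    "HOL-Computational_Algebra.Formal_Power_Series"
begin

text \<open>
  A vector in \<open>\<real>\<^sup>n\<close> with coordinates \<open>0, \<dots>, n - 1\<close> is a function \<open>nat \<Rightarrow> real\<close> that vanishes
  from \<open>n\<close> on, i.e. a point of \<^const>\<open>Euclidean_space\<close> \<open>n\<close>. The pointwise real vector space
  structure on functions makes \<^const>\<open>extreme_point_of\<close> applicable to sets of such vectors.
\<close>

instantiation "fun" :: (type, real_vector) real_vector
begin

definition scaleR_fun :: "real \<Rightarrow> ('a \<Rightarrow> 'b) \<Rightarrow> 'a \<Rightarrow> 'b" where
  "scaleR_fun c f = (\<lambda>x. c *\<^sub>R f x)"

instance
  by standard (simp_all add: scaleR_fun_def fun_eq_iff scaleR_add_left scaleR_add_right)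

end

abbreviation entry :: "nat \<Rightarrow> (nat \<Rightarrow> real) \<Rightarrow> nat \<Rightarrow> nat \<Rightarrow> real" where
  "entry p h r j \<equiv> h (j * p + r)"

definition gen_poly :: "nat \<Rightarrow> nat \<Rightarrow> (nat \<Rightarrow> real) \<Rightarrow> real fps" where
  "gen_poly p d h = (\<Sum>i<p * (d + 1). fps_const (h i) * fps_X ^ i)"

definition L_fun :: "nat \<Rightarrow> nat \<Rightarrow> (nat \<Rightarrow> real) \<Rightarrow> nat \<Rightarrow> real" where
  "L_fun p d h n = fps_nth (gen_poly p d h / (1 - fps_X ^ p) ^ (d + 1)) n"

definition C_from :: "nat \<Rightarrow> nat \<Rightarrow> nat \<Rightarrow> (nat \<Rightarrow> real) set" where
  "C_from p d N = {h \<in> topspace (Euclidean_space (p * (d + 1))).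
                \<forall>n\<ge>N. L_fun p d h (n + 1) \<ge> L_fun p d h n}"

definition C_END :: "nat \<Rightarrow> nat \<Rightarrow> (nat \<Rightarrow> real) set" where
  "C_END p d = (\<Union>N. C_from p d N)"

definition S1 :: "nat \<Rightarrow> nat \<Rightarrow> (nat \<Rightarrow> real) set" where
  "S1 p d = (Euclidean_space (p * (d + 1)) closure_of C_END p d) \<inter>
     {h \<in> topspace (Euclidean_space (p * (d + 1))).
        (\<forall>i<p * (d + 1). h i \<ge> 0) \<and> (\<Sum>j=0..d. entry p h 0 j) = 1}"

end

theory Submission
  imports Defs
begin

text \<open>
  For \<open>n\<close> in a fixed residue class modulo \<open>p\<close>, the difference \<open>L(n + 1) - L(n)\<close> is a polynomial in
  \<open>n\<close>, and its three top coefficients are, up to positive factors, the jumps of the sum, the first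
  moment and (when the previous ones vanish) the second moment of \<open>h\<close> between consecutive residue
  classes. So the closure of \<open>C_END\<close> is cut out by equal class sums and by the inequality
  \<open>\<mu>\<^bsub>r+1\<^esub> \<le> \<mu>\<^bsub>r\<^esub> + 1\<close> for the means, and on \<open>C_END\<close> itself the variance cannot
  drop from class \<open>r\<close> to class \<open>r + 1\<close> if that inequality is an equality (the link is tied).

  At a vertex every class has at most two support points, and no block of classes joined by tied
  links consists of two-point classes only, as its means could be moved simultaneously.
  If \<open>h\<^sub>i > h\<^bsub>i+1\<^esub>\<close> across a tied link, two two-point distributions with the same mean share a
  support point, and the larger weight there forces the larger variance: \<open>h \<notin> C_END\<close>. If the link
  is not tied, class \<open>i + 1\<close> starts a block; on \<open>C_END\<close> its positive variance propagates
  through the whole block, which contradicts extremality.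
\<close>

section \<open>Moments over residue classes\<close>

definition residue_class :: "nat \<Rightarrow> nat \<Rightarrow> nat \<Rightarrow> nat set" where
  "residue_class p d r = {i. i < p * (d + 1) \<and> i mod p = r}"

lemma finite_residue_class [simp]: "finite (residue_class p d r)"
  by (simp add: residue_class_def)

text \<open>The centre \<open>c\<close> is 1 for the class of \<open>n + 1\<close> and 0 for that of
  \<open>n\<close>, which absorbs the step from \<open>n\<close> to \<open>n + 1\<close>; with
  \<open>c\<close> a mean and \<open>k = 2\<close> it gives a variance.\<close>

definition moment :: "nat \<Rightarrow> nat \<Rightarrow> (nat \<Rightarrow> real) \<Rightarrow> real \<Rightarrow> nat \<Rightarrow> nat \<Rightarrow> real" where
  "moment p d h c k r = (\<Sum>i\<in>residue_class p d r. (real i - c) ^ k * h i)"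

subsection \<open>Coefficients of translated polynomials\<close>

lemma coeff_pcompose_translate:
  fixes P :: "real poly"
  assumes "degree P \<le> d"
  shows "coeff (pcompose P [:a, 1:]) k =
    (\<Sum>m\<le>d. coeff P m * (if k \<le> m then real (m choose k) * a ^ (m - k) else 0))"
proof -
  have P: "poly P x = (\<Sum>m\<le>d. coeff P m * x ^ m)" for x
    unfolding poly_altdef
    by (rule sum.mono_neutral_left) (use assms in \<open>auto simp: coeff_eq_0\<close>)
  have "pcompose P [:a, 1:] = (\<Sum>m\<le>d. smult (coeff P m) ([:a, 1:] ^ m))"
    by (rule poly_ext) (simp add: poly_pcompose P poly_sum)
  moreover have "coeff ([:a, 1:] ^ m) k = (if k \<le> m then real (m choose k) * a ^ (m - k) else 0)" for m
    by (auto simp: coeff_linear_poly_power intro!: coeff_eq_0 simp: degree_linear_power)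
  ultimately show ?thesis
    by (simp add: coeff_sum)
qed

lemma coeff_translate_top:
  fixes P :: "real poly"
  assumes "degree P \<le> d"
  shows "coeff (pcompose P [:a, 1:]) d = coeff P d"
proof -
  have "coeff (pcompose P [:a, 1:]) d = (\<Sum>m\<in>{d}. coeff P m * (if d \<le> m then real (m choose d) * a ^ (m - d) else 0))"
    unfolding coeff_pcompose_translate[OF assms]
    by (rule sum.mono_neutral_right) auto
  then show ?thesis by simp
qed

lemma coeff_translate_second:
  fixes P :: "real poly"
  assumes "degree P \<le> Suc e"
  shows "coeff (pcompose P [:a, 1:]) e = coeff P e + real (Suc e) * a * coeff P (Suc e)"
proof -
  have "coeff (pcompose P [:a, 1:]) e
      = (\<Sum>m\<in>{e, Suc e}. coeff P m * (if e \<le> m then real (m choose e) * a ^ (m - e) else 0))"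
    unfolding coeff_pcompose_translate[OF assms]
    by (rule sum.mono_neutral_right) auto
  then show ?thesis by simp
qed

lemma coeff_translate_third:
  fixes P :: "real poly"
  assumes "degree P \<le> Suc (Suc e)"
  shows "coeff (pcompose P [:a, 1:]) e = coeff P e + real (Suc e) * a * coeff P (Suc e)
    + real (Suc (Suc e) choose 2) * a\<^sup>2 * coeff P (Suc (Suc e))"
proof -
  have "coeff (pcompose P [:a, 1:]) e
      = (\<Sum>m\<in>{e, Suc e, Suc (Suc e)}. coeff P m * (if e \<le> m then real (m choose e) * a ^ (m - e) else 0))"
    unfolding coeff_pcompose_translate[OF assms]
    by (rule sum.mono_neutral_right) auto
  moreover have "Suc (Suc e) choose e = Suc (Suc e) choose 2"
    using binomial_symmetric[of 2 "Suc (Suc e)"] by simp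
  ultimately show ?thesis by (simp add: algebra_simps)
qed

text \<open>A negative coefficient at \<open>e\<close> would be the leading one and make
  \<open>q\<close> eventually negative. Arbitrarily large arguments must suffice, because each
  residue class is met only once in \<open>p\<close> steps.\<close>

lemma coeff_nonneg_if_frequently_nonneg:
  fixes q :: "real poly"
  assumes "degree q \<le> e" and "\<And>N. \<exists>n\<ge>N. poly q (real n) \<ge> 0"
  shows "coeff q e \<ge> 0"
proof (rule ccontr)
  assume neg: "\<not> coeff q e \<ge> 0"
  then have "degree q = e"
    by (intro antisym assms(1) le_degree) simp
  then have lc: "lead_coeff (- q) > 0"
    using neg by simp
  then obtain m where m: "\<And>x. x \<ge> m \<Longrightarrow> poly (- q) x \<ge> lead_coeff (- q)"
    using poly_pinfty_gt_lc by blast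
  obtain n where "n \<ge> nat \<lceil>m\<rceil>" "poly q (real n) \<ge> 0"
    using assms(2) by blast
  moreover from this have "real n \<ge> m" by linarith
  ultimately show False
    using m[of "real n"] lc by simp
qed

lemma eventually_nonneg_if_coeff_pos:
  fixes q :: "real poly"
  assumes "degree q \<le> e" and "coeff q e > 0"
  shows "\<forall>\<^sub>F n in sequentially. poly q (real n) \<ge> 0"
proof -
  have "degree q = e"
    using assms by (intro antisym le_degree) auto
  then have lc: "lead_coeff q > 0"
    using assms by simp
  then obtain m where m: "\<And>x. x \<ge> m \<Longrightarrow> poly q x \<ge> lead_coeff q"
    using poly_pinfty_gt_lc by blast
  show ?thesis
    using eventually_ge_at_top[of "nat \<lceil>m\<rceil>"]
  proof eventually_elim
    case (elim n)
    then have "real n \<ge> m" by linarith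
    with m[of "real n"] lc show ?case by simp
  qed
qed

subsection \<open>The quasi-polynomial \<open>L\<close>\<close>

text \<open>This is \<open>binom(x/p + d, d)\<close> as a polynomial in \<open>x\<close>; the
  built-in scaling allows evaluation at \<open>n - i\<close> without division by
  \<open>p\<close>.\<close>

primrec binom_poly :: "nat \<Rightarrow> nat \<Rightarrow> real poly" where
  "binom_poly p 0 = 1"
| "binom_poly p (Suc d) = binom_poly p d * [:1, 1 / (real p * real (Suc d)):]"

lemma degree_binom_poly:
  assumes "p \<ge> 1"
  shows "degree (binom_poly p d) = d"
proof (induction d)
  case (Suc d)
  have "binom_poly p d \<noteq> 0"
  proof (induction d)
    case (Suc d)
    then show ?case
      unfolding binom_poly.simps mult_eq_0_iff using assms by simp
  qed simp
  then show ?case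
    unfolding binom_poly.simps using assms Suc by (subst degree_mult_eq) auto
qed simp

lemma coeff_binom_poly_pos:
  assumes "p \<ge> 1"
  shows "coeff (binom_poly p d) d > 0"
proof -
  have "lead_coeff (binom_poly p d) > 0"
    by (induction d) (use assms in \<open>simp_all only: binom_poly.simps lead_coeff_mult\<close>, auto)
  then show ?thesis
    by (simp add: degree_binom_poly[OF assms])
qed

lemma poly_binom_poly:
  assumes "p \<ge> 1"
  shows "poly (binom_poly p d) (real (p * t)) = real ((t + d) choose d)"
proof (induction d)
  case (Suc d)
  have "real (Suc d) * real (Suc (t + d) choose Suc d) = real (Suc (t + d)) * real ((t + d) choose d)"
    using Suc_times_binomial[of d "t + d"] by (metis of_nat_mult)
  then have "real (Suc (t + d) choose Suc d) = real ((t + d) choose d) * (1 + real t / real (Suc d))"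
    by (simp add: field_simps)
  moreover have "1 + real (p * t) * (1 / (real p * real (Suc d))) = 1 + real t / real (Suc d)"
    using assms by simp
  then have "poly (binom_poly p (Suc d)) (real (p * t))
      = real ((t + d) choose d) * (1 + real t / real (Suc d))"
    unfolding binom_poly.simps poly_mult Suc by simp
  ultimately show ?case by simp
qed simp

text \<open>The power series of \<open>1 / (1 - z^p)^(e + 1)\<close>.\<close>

definition stretched_binomials :: "nat \<Rightarrow> nat \<Rightarrow> real fps" where
  "stretched_binomials p e = Abs_fps (\<lambda>n. if p dvd n then real ((n div p + e) choose e) else 0)"

declare binom_poly.simps [simp del]

text \<open>Multiplication by \<open>1 - z^p\<close> takes differences at distance \<open>p\<close>;
  on multiples of \<open>p\<close> these are given by Pascal's rule.\<close>

lemma stretched_binomials_mult: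
  assumes "p \<ge> 1"
  shows "stretched_binomials p 0 * (1 - fps_X ^ p) = 1"
    and "stretched_binomials p (Suc e) * (1 - fps_X ^ p) = stretched_binomials p e"
proof -
  have *: "fps_nth (stretched_binomials p k * (1 - fps_X ^ p)) n = fps_nth (stretched_binomials p k) n
     - (if n < p then 0 else fps_nth (stretched_binomials p k) (n - p))" for k n
    by (simp add: right_diff_distrib fps_X_power_mult_right_nth)
  have below: "\<not> p dvd n" if "n < p" "n \<noteq> 0" for n
    using that by (auto dest: dvd_imp_le)
  show "stretched_binomials p 0 * (1 - fps_X ^ p) = 1"
  proof (rule fps_ext)
    fix n
    show "fps_nth (stretched_binomials p 0 * (1 - fps_X ^ p)) n = fps_nth 1 n"
    proof (cases "n < p")
      case True
      then show ?thesis
        unfolding * using below[of n] by (cases "n = 0") (simp_all add: stretched_binomials_def)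
    next
      case False
      then obtain m where "n = m + p"
        by (metis add.commute le_Suc_ex not_less)
      then show ?thesis
        unfolding * using assms by (simp add: stretched_binomials_def)
    qed
  qed
  show "stretched_binomials p (Suc e) * (1 - fps_X ^ p) = stretched_binomials p e"
  proof (rule fps_ext)
    fix n
    show "fps_nth (stretched_binomials p (Suc e) * (1 - fps_X ^ p)) n = fps_nth (stretched_binomials p e) n"
    proof (cases "n < p")
      case True
      then show ?thesis
        unfolding * using below[of n] by (cases "n = 0") (simp_all add: stretched_binomials_def)
    next
      case False
      then obtain m where "n = m + p"
        by (metis add.commute le_Suc_ex not_less)
      then show ?thesis
        unfolding * using assms by (simp add: stretched_binomials_def)
    qed
  qed
qed

lemma stretched_binomials_inverse:
  assumes "p \<ge> 1"
  shows "stretched_binomials p e * (1 - fps_X ^ p) ^ (e + 1) = 1"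
proof (induction e)
  case (Suc e)
  have "stretched_binomials p (Suc e) * (1 - fps_X ^ p) ^ (Suc e + 1)
      = (stretched_binomials p (Suc e) * (1 - fps_X ^ p)) * (1 - fps_X ^ p) ^ (e + 1)"
    by (simp add: mult.assoc)
  also have "\<dots> = 1"
    unfolding stretched_binomials_mult(2)[OF assms] by (rule Suc)
  finally show ?case .
qed (use stretched_binomials_mult(1)[OF assms] in simp)

text \<open>In the convolution with \<open>1 / (1 - z^p)^(d + 1)\<close> only the indices congruent
  to \<open>n\<close> survive. The bound on \<open>n\<close> ensures \<open>i \<le> n\<close>, so
  that the subtraction \<open>n - i\<close> is not truncated and the binomial coefficient is a
  polynomial value.\<close>

lemma L_fun_eq:
  assumes p: "p \<ge> 1" and n: "n \<ge> p * (d + 1)"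
  shows "L_fun p d h n = (\<Sum>i\<in>residue_class p d (n mod p). h i * poly (binom_poly p d) (real n - real i))"
proof -
  let ?U = "(1 - fps_X ^ p :: real fps) ^ (d + 1)"
  have "fps_nth ?U 0 \<noteq> 0"
    using p by (simp add: fps_nth_power_0 power_0_left)
  then have "?U \<noteq> 0" by (metis fps_zero_nth)
  have "gen_poly p d h / ?U = (gen_poly p d h * stretched_binomials p d * ?U) / ?U"
    by (simp only: mult.assoc stretched_binomials_inverse[OF p] mult_1_right)
  also have "\<dots> = gen_poly p d h * stretched_binomials p d"
    using \<open>?U \<noteq> 0\<close> by (rule nonzero_mult_div_cancel_right)
  finally have "L_fun p d h n = fps_nth (gen_poly p d h * stretched_binomials p d) n"
    by (simp add: L_fun_def)
  also have "\<dots> = (\<Sum>i<p * (d + 1). h i * fps_nth (stretched_binomials p d) (n - i))"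
    unfolding gen_poly_def sum_distrib_right fps_sum_nth
    by (rule sum.cong) (use n in \<open>auto simp: mult.assoc fps_X_power_mult_nth\<close>)
  also have "\<dots> = (\<Sum>i\<in>residue_class p d (n mod p). h i * fps_nth (stretched_binomials p d) (n - i))"
  proof (rule sum.mono_neutral_right)
    show "\<forall>i\<in>{..<p * (d + 1)} - residue_class p d (n mod p). h i * fps_nth (stretched_binomials p d) (n - i) = 0"
    proof
      fix i assume "i \<in> {..<p * (d + 1)} - residue_class p d (n mod p)"
      then have "i \<le> n" "n mod p \<noteq> i mod p"
        using n by (auto simp: residue_class_def)
      then have "\<not> p dvd n - i"
        using mod_eq_dvd_iff_nat by blast
      then show "h i * fps_nth (stretched_binomials p d) (n - i) = 0"
        by (simp add: stretched_binomials_def)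
    qed
  qed (auto simp: residue_class_def)
  also have "\<dots> = (\<Sum>i\<in>residue_class p d (n mod p). h i * poly (binom_poly p d) (real n - real i))"
  proof (rule sum.cong)
    fix i assume i: "i \<in> residue_class p d (n mod p)"
    then have "i \<le> n" "n mod p = i mod p"
      using n by (auto simp: residue_class_def)
    then have "p dvd n - i"
      using mod_eq_dvd_iff_nat by blast
    then obtain t where t: "n - i = p * t" ..
    then have "real n - real i = real (p * t)"
      using \<open>i \<le> n\<close> by (metis of_nat_diff)
    then show "h i * fps_nth (stretched_binomials p d) (n - i) = h i * poly (binom_poly p d) (real n - real i)"
      using t p poly_binom_poly[OF p, of d t] by (simp add: stretched_binomials_def)
  qed simp
  finally show ?thesis .
qed

section \<open>Differences of \<open>L\<close> on one residue class and their top
  coefficients\<close>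

definition class_poly :: "nat \<Rightarrow> nat \<Rightarrow> (nat \<Rightarrow> real) \<Rightarrow> real \<Rightarrow> nat \<Rightarrow> real poly" where
  "class_poly p d h c r = (\<Sum>i\<in>residue_class p d r. smult (h i) (pcompose (binom_poly p d) [:- (real i - c), 1:]))"

text \<open>The class after \<open>p - 1\<close> is 0, with no correction for the wrap, because the
  class polynomials involve the actual indices \<open>i\<close> and not their quotients by
  \<open>p\<close>.\<close>

definition diff_poly :: "nat \<Rightarrow> nat \<Rightarrow> (nat \<Rightarrow> real) \<Rightarrow> nat \<Rightarrow> real poly" where
  "diff_poly p d h r = class_poly p d h 1 (Suc r mod p) - class_poly p d h 0 r"

lemma poly_diff_poly:
  assumes "p \<ge> 1" and "n \<ge> p * (d + 1)"
  shows "poly (diff_poly p d h (n mod p)) (real n) = L_fun p d h (n + 1) - L_fun p d h n"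
proof -
  have "Suc (n mod p) mod p = (n + 1) mod p"
    by (simp add: mod_Suc_eq)
  then show ?thesis
    using assms
    by (simp add: diff_poly_def class_poly_def poly_sum poly_pcompose L_fun_eq algebra_simps)
qed

lemma degree_diff_poly:
  assumes "p \<ge> 1"
  shows "degree (diff_poly p d h r) \<le> d"
  unfolding diff_poly_def class_poly_def
  by (intro degree_diff_le degree_sum_le)
    (auto intro!: order.trans[OF degree_smult_le] simp: degree_pcompose degree_binom_poly[OF assms])

lemma moment_power_0: "moment p d h 1 0 r = moment p d h 0 0 r"
  by (simp add: moment_def)

lemma coeff_diff_poly_top:
  assumes "p \<ge> 1"
  shows "coeff (diff_poly p d h r) d
    = coeff (binom_poly p d) d * (moment p d h 0 0 (Suc r mod p) - moment p d h 0 0 r)"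
  by (simp add: degree_binom_poly[OF assms] diff_poly_def class_poly_def coeff_sum coeff_translate_top moment_def
      sum_distrib_left sum_distrib_right algebra_simps)

text \<open>Translation by \<open>-(i - c)\<close> adds a multiple of the top coefficient linear in
  \<open>i - c\<close>, whence the first moment with a minus sign; the contribution of the
  untranslated coefficient cancels since the class sums agree.\<close>

lemma coeff_diff_poly_second:
  assumes "p \<ge> 1" and "moment p (Suc e) h 0 0 (Suc r mod p) = moment p (Suc e) h 0 0 r"
  shows "coeff (diff_poly p (Suc e) h r) e
    = real (Suc e) * coeff (binom_poly p (Suc e)) (Suc e) * (moment p (Suc e) h 0 1 r - moment p (Suc e) h 1 1 (Suc r mod p))"
proof -
  let ?B = "binom_poly p (Suc e)"
  have B: "degree ?B = Suc e"
    by (rule degree_binom_poly[OF assms(1)])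
  have "coeff (class_poly p (Suc e) h c s) e
      = coeff ?B e * moment p (Suc e) h c 0 s - real (Suc e) * coeff ?B (Suc e) * moment p (Suc e) h c 1 s" for c s
    unfolding class_poly_def coeff_sum coeff_smult moment_def sum_distrib_left
      coeff_translate_second[OF eq_imp_le[OF B]] sum_subtractf[symmetric]
    by (intro sum.cong refl) (simp add: algebra_simps)
  then show ?thesis
    by (simp only: diff_poly_def coeff_diff moment_power_0 assms(2)) (simp add: algebra_simps)
qed

text \<open>Equal sums and equal shifted first moments cancel all but the quadratic term of the
  translation, which enters with a plus sign.\<close>

lemma coeff_diff_poly_third:
  assumes "p \<ge> 1" and "d = Suc (Suc e)"
    and "moment p d h 0 0 (Suc r mod p) = moment p d h 0 0 r" and "moment p d h 1 1 (Suc r mod p) = moment p d h 0 1 r"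
  shows "coeff (diff_poly p d h r) e
    = real (d choose 2) * coeff (binom_poly p d) d * (moment p d h 1 2 (Suc r mod p) - moment p d h 0 2 r)"
proof -
  let ?B = "binom_poly p d"
  have B: "degree ?B = d"
    by (rule degree_binom_poly[OF assms(1)])
  have B': "degree ?B \<le> Suc (Suc e)"
    using B assms(2) by simp
  have "coeff (class_poly p d h c s) e
      = coeff ?B e * moment p d h c 0 s - real (Suc e) * coeff ?B (Suc e) * moment p d h c 1 s
        + real (Suc (Suc e) choose 2) * coeff ?B (Suc (Suc e)) * moment p d h c 2 s" for c s
    unfolding class_poly_def coeff_sum coeff_smult moment_def sum_distrib_left
      coeff_translate_third[OF B'] sum_subtractf[symmetric] sum.distrib[symmetric]
    by (intro sum.cong refl) (simp only: power_0 power_one_right power2_minus, simp add: ring_distribs)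
  then show ?thesis
    unfolding diff_poly_def coeff_diff assms(2)[symmetric] by (simp only: moment_power_0 assms(3,4) right_diff_distrib)
qed

section \<open>Moment conditions on \<open>C_END\<close>\<close>

lemma degree_le_if_coeff_0:
  assumes "degree q \<le> Suc e" and "coeff q (Suc e) = 0"
  shows "degree q \<le> e"
proof (intro degree_le allI impI)
  fix i assume "e < i"
  then show "coeff q i = 0"
    using assms by (cases "i = Suc e") (auto intro: coeff_eq_0)
qed

lemma zero_le_mult_pos_iff: "c > 0 \<Longrightarrow> 0 \<le> c * x \<longleftrightarrow> 0 \<le> x" for c x :: real
  by (simp add: zero_le_mult_iff)

text \<open>Extended periodically, \<open>f\<close> is monotone, and one turn of the cycle returns
  to the initial value.\<close>

lemma cyclic_nondecreasing_const:
  fixes f :: "nat \<Rightarrow> real"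
  assumes "\<And>r. r < p \<Longrightarrow> f r \<le> f (Suc r mod p)" and "r < p"
  shows "f r = f 0"
proof -
  have "f (n mod p) \<le> f (Suc n mod p)" for n
    using assms(1)[of "n mod p"] assms(2) by (simp add: mod_Suc_eq)
  then have "mono (\<lambda>n. f (n mod p))"
    by (simp add: mono_iff_le_Suc)
  from monoD[OF this, of 0 r] monoD[OF this, of r p] show ?thesis
    using assms(2) by simp
qed

lemma C_END_frequently:
  assumes p: "p \<ge> 1" and h: "h \<in> C_END p d" and r: "r < p"
  shows "\<exists>n\<ge>M. poly (diff_poly p d h r) (real n) \<ge> 0"
proof -
  obtain N where N: "\<And>n. n \<ge> N \<Longrightarrow> L_fun p d h (n + 1) \<ge> L_fun p d h n"
    using h by (auto simp: C_END_def C_from_def)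
  \<comment> \<open>This \<open>n\<close> lies in class \<open>r\<close>, beyond \<open>M\<close>
    and \<open>N\<close>, and in the range where \<open>L\<close> is given by the class
    polynomials.\<close>
  define n where "n = p * (M + N + d + 1) + r"
  have "p * (d + 1) \<le> p * (M + N + d + 1)"
    by (intro mult_le_mono2) simp
  then have n1: "p * (d + 1) \<le> n"
    unfolding n_def by (rule trans_le_add1)
  have "1 * (M + N + d + 1) \<le> p * (M + N + d + 1)"
    using p by (rule mult_le_mono1)
  then have "M + N + d + 1 \<le> n"
    unfolding n_def mult_1 by (rule trans_le_add1)
  then have n2: "M \<le> n" "N \<le> n"
    by simp_all
  have "n mod p = r"
    unfolding n_def mod_mult_self4 using r by (rule mod_less)
  then have "poly (diff_poly p d h r) (real n) \<ge> 0"
    using poly_diff_poly[OF p n1, of h] N[OF n2(2)] by simp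
  with n2(1) show ?thesis by blast
qed

text \<open>The nonnegative coefficient at \<open>d\<close> makes the class sums nondecreasing
  around the cycle, hence constant.\<close>

lemma C_END_moment_0:
  assumes p: "p \<ge> 1" and h: "h \<in> C_END p d" and r: "r < p"
  shows "moment p d h 0 0 r = moment p d h 0 0 0"
proof (rule cyclic_nondecreasing_const[OF _ r])
  fix s assume "s < p"
  then have "coeff (diff_poly p d h s) d \<ge> 0"
    using C_END_frequently[OF p h] degree_diff_poly[OF p] by (intro coeff_nonneg_if_frequently_nonneg)
  then show "moment p d h 0 0 s \<le> moment p d h 0 0 (Suc s mod p)"
    using coeff_binom_poly_pos[OF p, of d]
    by (simp add: coeff_diff_poly_top[OF p] zero_le_mult_pos_iff)
qed

lemma C_END_moment_0_Suc:
  assumes p: "p \<ge> 1" and h: "h \<in> C_END p d" and r: "r < p"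
  shows "moment p d h 0 0 (Suc r mod p) = moment p d h 0 0 r"
  using C_END_moment_0[OF p h r] C_END_moment_0[OF p h, of "Suc r mod p"] p by simp

lemma C_END_moment_1:
  assumes p: "p \<ge> 1" and d: "d \<ge> 1" and h: "h \<in> C_END p d" and r: "r < p"
  shows "degree (diff_poly p d h r) \<le> d - 1" and "moment p d h 1 1 (Suc r mod p) \<le> moment p d h 0 1 r"
proof -
  obtain e where e: "d = Suc e"
    using d by (cases d) auto
  note eq = C_END_moment_0_Suc[OF p h r]
  have "coeff (diff_poly p d h r) d = 0"
    using eq by (simp add: coeff_diff_poly_top[OF p])
  then show deg: "degree (diff_poly p d h r) \<le> d - 1"
    unfolding e diff_Suc_1 by (rule degree_le_if_coeff_0[OF degree_diff_poly[OF p]])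
  then have "coeff (diff_poly p d h r) e \<ge> 0"
    unfolding e diff_Suc_1 using C_END_frequently[OF p h r, unfolded e]
    by (intro coeff_nonneg_if_frequently_nonneg)
  then show "moment p d h 1 1 (Suc r mod p) \<le> moment p d h 0 1 r"
    using coeff_binom_poly_pos[OF p, of d] unfolding e
    by (simp add: coeff_diff_poly_second[OF p eq[unfolded e]] zero_le_mult_pos_iff)
qed

text \<open>Equal sums and a tied link remove the two top coefficients, so the sign condition falls
  on the third; \<open>d \<ge> 2\<close> is what makes it exist.\<close>

lemma C_END_moment_2:
  assumes p: "p \<ge> 1" and d: "d \<ge> 2" and h: "h \<in> C_END p d" and r: "r < p"
    and tied: "moment p d h 1 1 (Suc r mod p) = moment p d h 0 1 r"
  shows "moment p d h 0 2 r \<le> moment p d h 1 2 (Suc r mod p)"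
proof -
  obtain e where e: "d = Suc (Suc e)"
    using d by (cases d rule: old.nat.exhaust; cases "d - 1") auto
  note eq = C_END_moment_0_Suc[OF p h r]
  have "degree (diff_poly p d h r) \<le> Suc e"
    using C_END_moment_1(1)[OF p _ h r] e by simp
  moreover have "coeff (diff_poly p d h r) (Suc e) = 0"
    using coeff_diff_poly_second[OF p eq[unfolded e]] tied unfolding e by simp
  ultimately have "degree (diff_poly p d h r) \<le> e"
    by (rule degree_le_if_coeff_0)
  then have "coeff (diff_poly p d h r) e \<ge> 0"
    using C_END_frequently[OF p h r] by (intro coeff_nonneg_if_frequently_nonneg)
  moreover have "d choose 2 > 0"
    using d by simp
  ultimately show ?thesis
    using coeff_binom_poly_pos[OF p, of d]
    by (simp add: coeff_diff_poly_third[OF p e eq tied] zero_le_mult_pos_iff)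
qed

text \<open>Strictness makes the coefficient at \<open>d - 1\<close> positive, so each of the
  finitely many class polynomials is eventually nonnegative.\<close>

lemma C_END_if_strict:
  assumes p: "p \<ge> 1" and d: "d \<ge> 1" and h: "h \<in> topspace (Euclidean_space (p * (d + 1)))"
    and sums: "\<And>r. r < p \<Longrightarrow> moment p d h 0 0 (Suc r mod p) = moment p d h 0 0 r"
    and strict: "\<And>r. r < p \<Longrightarrow> moment p d h 1 1 (Suc r mod p) < moment p d h 0 1 r"
  shows "h \<in> C_END p d"
proof -
  obtain e where e: "d = Suc e"
    using d by (cases d) auto
  have "\<forall>\<^sub>F n in sequentially. poly (diff_poly p d h r) (real n) \<ge> 0" if r: "r < p" for r
  proof (rule eventually_nonneg_if_coeff_pos)
    have "coeff (diff_poly p d h r) d = 0"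
      using sums[OF r] by (simp add: coeff_diff_poly_top[OF p])
    then show "degree (diff_poly p d h r) \<le> e"
      unfolding e diff_Suc_1 by (rule degree_le_if_coeff_0[OF degree_diff_poly[OF p]])
    show "coeff (diff_poly p d h r) e > 0"
      using coeff_binom_poly_pos[OF p, of d] strict[OF r] unfolding e
      by (simp add: coeff_diff_poly_second[OF p sums[OF r, unfolded e]])
  qed
  then have "\<forall>\<^sub>F n in sequentially. \<forall>r\<in>{..<p}. poly (diff_poly p d h r) (real n) \<ge> 0"
    by (intro eventually_ball_finite) auto
  then have "\<forall>\<^sub>F n in sequentially. L_fun p d h (n + 1) \<ge> L_fun p d h n"
    using eventually_ge_at_top[of "p * (d + 1)"]
  proof eventually_elim
    case (elim n)
    then have "poly (diff_poly p d h (n mod p)) (real n) \<ge> 0"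
      using p by simp
    then show ?case
      using poly_diff_poly[OF p elim(2), of h] by simp
  qed
  then obtain N where "\<forall>n\<ge>N. L_fun p d h (n + 1) \<ge> L_fun p d h n"
    unfolding eventually_sequentially ..
  then show ?thesis
    using h unfolding C_END_def C_from_def by blast
qed

lemma moment_add_scaled: "moment p d (\<lambda>i. h i + a * g i) c k r = moment p d h c k r + a * moment p d g c k r"
  by (simp add: moment_def sum.distrib sum_distrib_left algebra_simps)

subsection \<open>The closure of \<open>C_END\<close>\<close>

lemma moment_1_1: "moment p d h 1 1 r = moment p d h 0 1 r - moment p d h 0 0 r"
  by (simp add: moment_def sum_subtractf algebra_simps)

text \<open>For class sums 1 the inequality bounds the mean of each class by that of its predecessor
  plus 1. For \<open>p, d \<ge> 1\<close> this set turns out to be the closure of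
  \<open>C_END\<close>.\<close>

definition moment_cone :: "nat \<Rightarrow> nat \<Rightarrow> (nat \<Rightarrow> real) set" where
  "moment_cone p d = {h \<in> topspace (Euclidean_space (p * (d + 1))). \<forall>r<p.
     moment p d h 0 0 (Suc r mod p) = moment p d h 0 0 r \<and> moment p d h 1 1 (Suc r mod p) \<le> moment p d h 0 1 r}"

lemma closedin_cone: "closedin (Euclidean_space (p * (d + 1))) (moment_cone p d)"
proof -
  have cont: "continuous_on UNIV (\<lambda>h. moment p d h c k r)" for c k r
    unfolding moment_def by (intro continuous_intros continuous_on_product_coordinates)
  have "moment_cone p d = topspace (Euclidean_space (p * (d + 1))) \<inter>
    (\<Inter>r\<in>{..<p}. {h. moment p d h 0 0 (Suc r mod p) = moment p d h 0 0 r} \<inter> {h. moment p d h 1 1 (Suc r mod p) \<le> moment p d h 0 1 r})"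
    by (auto simp: moment_cone_def)
  also have "closed \<dots>"
    by (intro closed_Int closed_INT ballI closed_Collect_eq closed_Collect_le cont)
      (rule closedin_Euclidean_imp_closed[OF closedin_topspace])
  finally show ?thesis
    by (auto simp: closedin_Euclidean_space_iff moment_cone_def)
qed

text \<open>
  With all class sums 1 and all class means 0, every inequality of \<open>moment_cone\<close> is strict; such a
  point lets us push any point of the cone into \<open>C_END\<close>.
\<close>
lemma ex_means_0:
  assumes p: "p \<ge> 1" and d: "d \<ge> 1"
  shows "\<exists>g \<in> topspace (Euclidean_space (p * (d + 1))). \<forall>r<p.
     moment p d g 0 0 r = 1 \<and> moment p d g 0 1 r = 0"
proof -
  \<comment> \<open>Class \<open>r\<close> gets weight \<open>1 + r/p\<close> at \<open>r\<close>
    and \<open>-r/p\<close> at \<open>r + p\<close>: the affine combination of these two indices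
    that equals 0. Negative weights are allowed in the cone.\<close>
  define g :: "nat \<Rightarrow> real" where
    "g = (\<lambda>i. if i < p then 1 + real i / real p else if i < 2 * p then 1 - real i / real p else 0)"
  have pd: "2 * p \<le> p * (d + 1)"
    using d mult_le_mono2[of 2 "d + 1" p] by (simp add: mult.commute)
  have moment: "moment p d g 0 k r = real r ^ k * (1 + real r / real p) - real (r + p) ^ k * (real r / real p)"
    if r: "r < p" for k r
  proof -
    have *: "g i = 0" if "i mod p = r" "i \<notin> {r, r + p}" for i
    proof (rule ccontr)
      assume "g i \<noteq> 0"
      then have "i < 2 * p"
        by (auto simp: g_def split: if_splits)
      then show False
        using that r by (cases "i < p") (auto simp: le_mod_geq not_less)
    qed
    have "moment p d g 0 k r = (\<Sum>i\<in>{r, r + p}. (real i - 0) ^ k * g i)"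
      unfolding moment_def
    proof (rule sum.mono_neutral_right)
      have "r < p * (d + 1)" "r + p < p * (d + 1)"
        using r pd by linarith+
      then show "{r, r + p} \<subseteq> residue_class p d r"
        using r by (auto simp: residue_class_def)
      show "\<forall>i\<in>residue_class p d r - {r, r + p}. (real i - 0) ^ k * g i = 0"
        using * by (auto simp: residue_class_def)
    qed simp
    then show ?thesis
      using r p by (simp add: g_def field_simps)
  qed
  have "g \<in> topspace (Euclidean_space (p * (d + 1)))"
    unfolding topspace_Euclidean_space mem_Collect_eq
  proof (intro allI impI)
    fix i assume "p * (d + 1) \<le> i"
    then have "\<not> i < 2 * p" "\<not> i < p"
      using pd by linarith+
    then show "g i = 0"
      by (simp add: g_def)
  qed
  moreover have "moment p d g 0 0 r = 1 \<and> moment p d g 0 1 r = 0" if "r < p" for r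
    using p by (simp add: moment[OF that] field_simps)
  ultimately show ?thesis by blast
qed

text \<open>The cone is closed and contains \<open>C_END\<close>; conversely each of its points is
  the limit of \<open>h + a g\<close> in \<open>C_END\<close> as \<open>a\<close> decreases to
  0.\<close>

lemma closure_C_END:
  assumes p: "p \<ge> 1" and d: "d \<ge> 1"
  shows "Euclidean_space (p * (d + 1)) closure_of C_END p d = moment_cone p d"
proof
  let ?E = "topspace (Euclidean_space (p * (d + 1)))"
  show "Euclidean_space (p * (d + 1)) closure_of C_END p d \<subseteq> moment_cone p d"
  proof (rule closure_of_minimal[OF _ closedin_cone], rule subsetI)
    fix h assume h: "h \<in> C_END p d"
    then show "h \<in> moment_cone p d"
      using C_END_moment_0_Suc[OF p h] C_END_moment_1(2)[OF p d h]
      by (auto simp: moment_cone_def C_END_def C_from_def)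
  qed
  show "moment_cone p d \<subseteq> Euclidean_space (p * (d + 1)) closure_of C_END p d"
  proof
    fix h assume h: "h \<in> moment_cone p d"
    obtain g where gE: "g \<in> ?E" and g: "\<And>r. r < p \<Longrightarrow> moment p d g 0 0 r = 1 \<and> moment p d g 0 1 r = 0"
      using ex_means_0[OF p d] by blast
    define f where "f = (\<lambda>a. \<lambda>i. h i + a * g i)"
    have mem: "f a \<in> C_END p d" if "a > 0" for a
    proof (rule C_END_if_strict[OF p d])
      show "f a \<in> ?E"
        using h gE by (auto simp: f_def moment_cone_def topspace_Euclidean_space)
      fix r assume r: "r < p"
      have r': "Suc r mod p < p"
        using p by simp
      show "moment p d (f a) 0 0 (Suc r mod p) = moment p d (f a) 0 0 r"
        using h r g[OF r] g[OF r'] by (auto simp: f_def moment_add_scaled moment_cone_def)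
      have "moment p d h 1 1 (Suc r mod p) \<le> moment p d h 0 1 r"
        using h r by (auto simp: moment_cone_def)
      moreover have "moment p d g 1 1 (Suc r mod p) = - 1"
        using g[OF r'] by (simp add: moment_1_1 del: One_nat_def)
      ultimately show "moment p d (f a) 1 1 (Suc r mod p) < moment p d (f a) 0 1 r"
        using g[OF r] that by (simp add: f_def moment_add_scaled)
    qed
    \<comment> \<open>Since 0 lies in the closure of the positive reals, continuity carries
      \<open>f 0 = h\<close> into the closure of \<open>C_END\<close>.\<close>
    have "continuous_on (closure {0<..}) f"
      unfolding f_def by (intro continuous_on_coordinatewise_then_product continuous_intros)
    then have "f ` closure {0<..} \<subseteq> closure (C_END p d)"
      by (rule image_closure_subset) (use mem closure_subset in auto)
    then have "f 0 \<in> closure (C_END p d)"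
      by (simp add: image_subset_iff)
    then have "h \<in> closure (C_END p d)"
      by (simp add: f_def)
    moreover have "{x. \<forall>i\<ge>p * (d + 1). x i = 0} \<inter> C_END p d = C_END p d"
      by (auto simp: C_END_def C_from_def topspace_Euclidean_space)
    ultimately show "h \<in> Euclidean_space (p * (d + 1)) closure_of C_END p d"
      using h by (simp add: Euclidean_space_def closure_of_subtopology euclidean_product_topology
          moment_cone_def topspace_Euclidean_space)
  qed
qed

lemma sum_entry_0:
  assumes "p \<ge> 1"
  shows "(\<Sum>j=0..d. entry p h 0 j) = moment p d h 0 0 0"
proof -
  have "residue_class p d 0 = (\<lambda>j. j * p) ` {0..d}"
  proof
    show "residue_class p d 0 \<subseteq> (\<lambda>j. j * p) ` {0..d}"
    proof
      fix i assume "i \<in> residue_class p d 0"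
      then obtain j where "i = j * p" "i < p * (d + 1)"
        by (auto simp: residue_class_def mod_eq_0_iff_dvd dvd_def mult.commute)
      moreover from this have "j < d + 1"
        by (metis mult.commute mult_less_cancel1)
      ultimately show "i \<in> (\<lambda>j. j * p) ` {0..d}"
        by auto
    qed
    have "j * p < p * (d + 1)" if "j \<le> d" for j
      using that assms by (simp add: mult.commute[of j p] del: mult_Suc_right)
    then show "(\<lambda>j. j * p) ` {0..d} \<subseteq> residue_class p d 0"
      by (auto simp: residue_class_def)
  qed
  moreover have "inj_on (\<lambda>j. j * p) {0..d}"
    using assms by (auto simp: inj_on_def)
  ultimately show ?thesis
    by (simp add: moment_def sum.reindex)
qed

text \<open>Normalising class 0 normalises every class, as all class sums agree on the cone.\<close>

lemma mem_S1_iff: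
  assumes p: "p \<ge> 1" and d: "d \<ge> 1"
  shows "h \<in> S1 p d \<longleftrightarrow>
    h \<in> moment_cone p d \<and> (\<forall>i<p * (d + 1). h i \<ge> 0) \<and> (\<forall>r<p. moment p d h 0 0 r = 1)"
proof -
  have eq: "moment p d h 0 0 r = moment p d h 0 0 0" if h: "h \<in> moment_cone p d" and r: "r < p" for r
  proof (rule cyclic_nondecreasing_const[OF _ r])
    fix s assume "s < p"
    with h show "moment p d h 0 0 s \<le> moment p d h 0 0 (Suc s mod p)"
      unfolding moment_cone_def by (simp only: mem_Collect_eq order_refl)
  qed
  have "h \<in> moment_cone p d \<Longrightarrow>
      moment p d h 0 0 0 = 1 \<longleftrightarrow> (\<forall>r<p. moment p d h 0 0 r = 1)"
    using eq p by (metis less_le_trans zero_less_one)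
  moreover have "moment_cone p d \<subseteq> topspace (Euclidean_space (p * (d + 1)))"
    unfolding moment_cone_def by blast
  ultimately show ?thesis
    unfolding S1_def closure_C_END[OF p d] sum_entry_0[OF p] by blast
qed

lemma moment_restrict:
  assumes "A \<subseteq> residue_class p d r" and "\<And>i. i \<in> residue_class p d r \<Longrightarrow> i \<notin> A \<Longrightarrow> h i = 0"
  shows "moment p d h c k r = (\<Sum>i\<in>A. (real i - c) ^ k * h i)"
  unfolding moment_def using assms by (intro sum.mono_neutral_right) auto

lemma eventually_nonneg_affine:
  fixes x y :: real
  assumes "x \<ge> 0" and "x = 0 \<Longrightarrow> y = 0"
  shows "\<forall>\<^sub>F a in at_right 0. x + a * y \<ge> 0"
proof (cases "x = 0")
  case False
  have "((\<lambda>a. x + a * y) \<longlongrightarrow> x + 0 * y) (at_right 0)"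
    by (intro tendsto_intros)
  then have "\<forall>\<^sub>F a in at_right 0. x + a * y > 0"
    using assms(1) False by (intro order_tendstoD(1)) auto
  then show ?thesis
    by eventually_elim simp
qed (use assms in simp)

lemma S1_D:
  assumes "p \<ge> 1" and "d \<ge> 1" and "h \<in> S1 p d"
  shows "h \<in> topspace (Euclidean_space (p * (d + 1)))"
    and "h i \<ge> 0"
    and "r < p \<Longrightarrow> moment p d h 0 0 r = 1"
    and "r < p \<Longrightarrow> moment p d h 1 1 (Suc r mod p) \<le> moment p d h 0 1 r"
proof -
  note h = assms(3)[unfolded mem_S1_iff[OF assms(1,2)] moment_cone_def]
  show E: "h \<in> topspace (Euclidean_space (p * (d + 1)))"
    using h by blast
  show "h i \<ge> 0"
    using h E unfolding topspace_Euclidean_space by (cases "i < p * (d + 1)") auto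
  show "r < p \<Longrightarrow> moment p d h 0 0 r = 1" "r < p \<Longrightarrow> moment p d h 1 1 (Suc r mod p) \<le> moment p d h 0 1 r"
    using h by blast+
qed

subsection \<open>Vertices of \<open>S1\<close>\<close>

text \<open>The direction \<open>v\<close> leaves active constraints unchanged, and the finitely
  many slack ones survive a small step. As the class sums of \<open>v\<close> vanish, its first
  moments do not depend on the centre.\<close>

lemma eventually_perturbed_in_S1:
  assumes p: "p \<ge> 1" and d: "d \<ge> 1" and h: "h \<in> S1 p d"
    and supp: "\<And>i. h i = 0 \<Longrightarrow> v i = 0"
    and sums: "\<And>r. r < p \<Longrightarrow> moment p d v 0 0 r = 0"
    and tied: "\<And>r. r < p \<Longrightarrow> moment p d h 1 1 (Suc r mod p) = moment p d h 0 1 r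
      \<Longrightarrow> moment p d v 0 1 (Suc r mod p) = moment p d v 0 1 r"
  shows "\<forall>\<^sub>F a in at_right 0. (\<lambda>i. h i + a * v i) \<in> S1 p d"
proof -
  note S1 = S1_D[OF p d h]
  have r': "Suc r mod p < p" for r
    using p by simp
  have "\<forall>\<^sub>F a in at_right 0. \<forall>i\<in>{..<p * (d + 1)}. h i + a * v i \<ge> 0"
    using S1(2) supp by (intro eventually_ball_finite ballI eventually_nonneg_affine) auto
  moreover have "\<forall>\<^sub>F a in at_right 0. \<forall>r\<in>{..<p}. (moment p d h 0 1 r - moment p d h 1 1 (Suc r mod p))
      + a * (moment p d v 0 1 r - moment p d v 1 1 (Suc r mod p)) \<ge> 0"
  proof (intro eventually_ball_finite ballI eventually_nonneg_affine)
    fix r assume r: "r \<in> {..<p}"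
    then show "moment p d h 0 1 r - moment p d h 1 1 (Suc r mod p) \<ge> 0"
      using S1(4)[of r] by simp
    assume "moment p d h 0 1 r - moment p d h 1 1 (Suc r mod p) = 0"
    then have "moment p d v 0 1 (Suc r mod p) = moment p d v 0 1 r"
      using r by (intro tied) auto
    then show "moment p d v 0 1 r - moment p d v 1 1 (Suc r mod p) = 0"
      unfolding moment_1_1 using sums[OF r'] by simp
  qed simp
  ultimately show ?thesis
  proof eventually_elim
    case (elim a)
    have "(\<lambda>i. h i + a * v i) \<in> topspace (Euclidean_space (p * (d + 1)))"
      using S1(1) supp by (auto simp: topspace_Euclidean_space)
    moreover have "moment p d h 1 1 (Suc r mod p) + a * moment p d v 1 1 (Suc r mod p)
        \<le> moment p d h 0 1 r + a * moment p d v 0 1 r" if "r < p" for r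
    proof -
      have "0 \<le> (moment p d h 0 1 r - moment p d h 1 1 (Suc r mod p))
          + a * (moment p d v 0 1 r - moment p d v 1 1 (Suc r mod p))"
        using elim(2) that by blast
      then show ?thesis
        unfolding right_diff_distrib by linarith
    qed
    ultimately show ?case
      unfolding mem_S1_iff[OF p d] moment_cone_def mem_Collect_eq moment_add_scaled
      using elim(1) S1(3) sums r' by simp
  qed
qed

text \<open>Both \<open>v\<close> and \<open>-v\<close> are admissible directions, so a nonzero
  \<open>v\<close> would make \<open>h\<close> the midpoint of a segment in
  \<open>S1\<close>.\<close>

lemma extreme_point_S1_rigid:
  assumes p: "p \<ge> 1" and d: "d \<ge> 1" and ext: "h extreme_point_of S1 p d"
    and supp: "\<And>i. h i = 0 \<Longrightarrow> v i = 0"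
    and sums: "\<And>r. r < p \<Longrightarrow> moment p d v 0 0 r = 0"
    and tied: "\<And>r. r < p \<Longrightarrow> moment p d h 1 1 (Suc r mod p) = moment p d h 0 1 r
      \<Longrightarrow> moment p d v 0 1 (Suc r mod p) = moment p d v 0 1 r"
  shows "v i = 0"
proof (rule ccontr)
  assume vi: "v i \<noteq> 0"
  have h: "h \<in> S1 p d"
    using ext by (simp add: extreme_point_of_def)
  have neg: "moment p d (\<lambda>i. - v i) c k r = - moment p d v c k r" for c k r
    by (simp add: moment_def sum_negf)
  have "\<forall>\<^sub>F a in at_right 0. (\<lambda>i. h i + a * v i) \<in> S1 p d"
    by (rule eventually_perturbed_in_S1[OF p d h supp sums tied])
  moreover have "\<forall>\<^sub>F a in at_right 0. (\<lambda>i. h i + a * - v i) \<in> S1 p d"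
    by (rule eventually_perturbed_in_S1[OF p d h]) (use supp sums tied in \<open>simp_all add: neg\<close>)
  moreover have "\<forall>\<^sub>F a in at_right 0. a > (0::real)"
    by (rule eventually_at_right_less)
  ultimately have "\<forall>\<^sub>F a in at_right 0. (\<lambda>i. h i + a * v i) \<in> S1 p d \<and>
      (\<lambda>i. h i + a * - v i) \<in> S1 p d \<and> a > 0"
    by eventually_elim blast
  then obtain a where a: "(\<lambda>i. h i + a * v i) \<in> S1 p d" "(\<lambda>i. h i + a * - v i) \<in> S1 p d" "a > 0"
    by (metis (mono_tags, lifting) eventually_happens trivial_limit_at_right_real)
  have "h = (1 - 1/2) *\<^sub>R (\<lambda>i. h i + a * v i) + (1/2) *\<^sub>R (\<lambda>i. h i + a * - v i)"
    by (simp add: fun_eq_iff scaleR_fun_def field_simps)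
  moreover have "(\<lambda>i. h i + a * v i) \<noteq> (\<lambda>i. h i + a * - v i)"
    using vi a(3) by (auto simp: fun_eq_iff intro!: exI[of _ i])
  ultimately have "h \<in> open_segment (\<lambda>i. h i + a * v i) (\<lambda>i. h i + a * - v i)"
    unfolding in_segment by (intro conjI exI[of _ "1/2"]) simp_all
  then show False
    using ext a(1,2) by (auto simp: extreme_point_of_def)
qed

lemma extreme_point_S1_support_le_2:
  assumes p: "p \<ge> 1" and d: "d \<ge> 1" and ext: "h extreme_point_of S1 p d"
    and abc: "a \<in> residue_class p d r" "b \<in> residue_class p d r" "c \<in> residue_class p d r" "a \<noteq> b" "a \<noteq> c" "b \<noteq> c"
    and nz: "h a \<noteq> 0" "h b \<noteq> 0" "h c \<noteq> 0"
  shows False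
proof -
  \<comment> \<open>The affine dependence of three points on a line: its weights have sum 0 and
    first moment 0.\<close>
  define v where "v = (\<lambda>i. if i = a then real c - real b else if i = b then real a - real c
    else if i = c then real b - real a else 0)"
  have moment: "moment p d v 0 k s = 0" if "k \<le> 1" for k s
  proof (cases "s = r")
    case True
    have "moment p d v 0 k s = (\<Sum>i\<in>{a, b, c}. (real i - 0) ^ k * v i)"
      unfolding True by (rule moment_restrict) (use abc in \<open>auto simp: v_def\<close>)
    also have "\<dots> = real a ^ k * (real c - real b) + real b ^ k * (real a - real c) + real c ^ k * (real b - real a)"
      using abc by (simp add: v_def)
    also have "\<dots> = 0"
      using that by (cases k) (auto simp: algebra_simps)
    finally show ?thesis .
  next
    case False
    then have "moment p d v 0 k s = (\<Sum>i\<in>{}. (real i - 0) ^ k * v i)"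
      by (intro moment_restrict) (use abc in \<open>auto simp: v_def residue_class_def\<close>)
    then show ?thesis by simp
  qed
  have "v a = 0"
    by (rule extreme_point_S1_rigid[OF p d ext]) (use nz in \<open>auto simp: moment, auto simp: v_def\<close>)
  then show False
    using abc by (simp add: v_def)
qed

section \<open>Tied links and blocks of classes\<close>

definition tied :: "nat \<Rightarrow> nat \<Rightarrow> (nat \<Rightarrow> real) \<Rightarrow> nat \<Rightarrow> bool" where
  "tied p d h r \<longleftrightarrow> moment p d h 1 1 (Suc r mod p) = moment p d h 0 1 r"

text \<open>For nonnegative entries with class sum 1 this means that the class has positive variance
  as a probability distribution.\<close>

definition split_class :: "nat \<Rightarrow> nat \<Rightarrow> (nat \<Rightarrow> real) \<Rightarrow> nat \<Rightarrow> bool" where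
  "split_class p d h r \<longleftrightarrow> (\<exists>a\<in>residue_class p d r. \<exists>b\<in>residue_class p d r. a \<noteq> b \<and> h a \<noteq> 0 \<and> h b \<noteq> 0)"

text \<open>Shifting mass between two support points moves the mean of a split class. Doing so at
  the same rate throughout \<open>B\<close> keeps every tied link tied, since no tied link leaves or
  enters \<open>B\<close>; this contradicts rigidity.\<close>

lemma extreme_point_S1_no_split_block:
  assumes p: "p \<ge> 1" and d: "d \<ge> 1" and ext: "h extreme_point_of S1 p d"
    and B: "\<And>r. r < p \<Longrightarrow> tied p d h r \<Longrightarrow> Suc r mod p \<in> B \<longleftrightarrow> r \<in> B"
    and split: "\<And>r. r \<in> B \<Longrightarrow> split_class p d h r"
  shows "B = {}"
proof (rule ccontr)
  assume "B \<noteq> {}"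
  then obtain r0 where r0: "r0 \<in> B" by blast
  have "\<forall>r. \<exists>a b. r \<in> B \<longrightarrow> a \<in> residue_class p d r \<and> b \<in> residue_class p d r \<and> a \<noteq> b \<and> h a \<noteq> 0 \<and> h b \<noteq> 0"
    using split unfolding split_class_def by blast
  then obtain a b where ab:
    "\<And>r. r \<in> B \<Longrightarrow> a r \<in> residue_class p d r \<and> b r \<in> residue_class p d r \<and> a r \<noteq> b r \<and> h (a r) \<noteq> 0 \<and> h (b r) \<noteq> 0"
    by metis
  \<comment> \<open>The weights are scaled to give first moment exactly 1 in every class of
    \<open>B\<close>.\<close>
  define v where "v = (\<lambda>i. let r = i mod p in if r \<notin> B then 0
    else if i = b r then 1 / (real (b r) - real (a r))
    else if i = a r then - 1 / (real (b r) - real (a r)) else 0)"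
  have mod: "i mod p = r" if "i \<in> residue_class p d r" for i r
    using that by (simp add: residue_class_def)
  have moment: "moment p d v 0 k r = (if r \<in> B then of_nat k else 0)" if "k \<le> 1" for k r
  proof (cases "r \<in> B")
    case True
    note abr = ab[OF True]
    have v: "v (a r) = - 1 / (real (b r) - real (a r))" "v (b r) = 1 / (real (b r) - real (a r))"
      using abr mod[of "a r" r] mod[of "b r" r] True by (auto simp: v_def)
    have "moment p d v 0 k r = (\<Sum>i\<in>{a r, b r}. (real i - 0) ^ k * v i)"
      by (rule moment_restrict) (use abr mod in \<open>auto simp: v_def\<close>)
    also have "\<dots> = (real (b r) ^ k - real (a r) ^ k) / (real (b r) - real (a r))"
      using abr by (simp add: v diff_divide_distrib)
    also have "\<dots> = of_nat k"
    proof (cases "k = 0")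
      case False
      then have "k = 1" using that by simp
      then show ?thesis using abr by simp
    qed simp
    finally show ?thesis
      using True by simp
  next
    case False
    then have "moment p d v 0 k r = (\<Sum>i\<in>{}. (real i - 0) ^ k * v i)"
      by (intro moment_restrict) (use mod in \<open>auto simp: v_def\<close>)
    then show ?thesis using False by simp
  qed
  have "v (b r0) = 0"
  proof (rule extreme_point_S1_rigid[OF p d ext])
    show "v i = 0" if "h i = 0" for i
      using that ab[of "i mod p"] by (auto simp: v_def Let_def)
    show "moment p d v 0 0 r = 0" for r
      by (simp add: moment)
    show "moment p d v 0 1 (Suc r mod p) = moment p d v 0 1 r"
      if "r < p" "moment p d h 1 1 (Suc r mod p) = moment p d h 0 1 r" for r
      using B[of r] that by (simp only: moment order_refl tied_def)
  qed
  then show False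
    using ab[OF r0] mod[of "b r0" r0] r0 by (simp add: v_def Let_def)
qed

section \<open>Variances across a tied link\<close>

lemma two_le_if_three_congruent:
  assumes "a < m" "m < b" "a mod p = m mod p" "m mod p = b mod p" "b < p * (d + 1)"
  shows "d \<ge> (2::nat)"
proof -
  have "p dvd m - a" "p dvd b - m"
    using assms(1-4) mod_eq_dvd_iff_nat[of a m p] mod_eq_dvd_iff_nat[of m b p] by auto
  \<comment> \<open>Distinct congruent indices are at least \<open>p\<close> apart, so the three
    span at least \<open>2 * p\<close>.\<close>
  then have "p \<le> m - a" "p \<le> b - m"
    using assms(1,2) by (auto intro: dvd_imp_le)
  then have "p * 2 < p * (d + 1)"
    using assms(1,2,5) by linarith
  then show ?thesis
    unfolding mult_less_cancel1 by simp
qed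

lemma mod_Suc_cancel: "Suc a mod p = Suc b mod p \<Longrightarrow> a mod p = b mod p"
  by (auto simp: mod_Suc split: if_splits)

lemma ex_other_support:
  assumes "moment p d h 0 0 r = 1" and "a \<in> residue_class p d r" and "h a \<noteq> 1"
  shows "\<exists>b\<in>residue_class p d r. b \<noteq> a \<and> h b \<noteq> 0"
proof (rule ccontr)
  assume *: "\<not> ?thesis"
  have "moment p d h 0 0 r = (\<Sum>i\<in>{a}. (real i - 0) ^ 0 * h i)"
    by (rule moment_restrict) (use assms(2) * in auto)
  then show False
    using assms(1,3) by simp
qed

lemma sum_eq_0_ex_signs:
  fixes f :: "'a \<Rightarrow> real"
  assumes "finite A" "sum f A = 0" "a \<in> A" "f a \<noteq> 0"
  shows "\<exists>x\<in>A. f x < 0" and "\<exists>x\<in>A. f x > 0"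
proof -
  show "\<exists>x\<in>A. f x < 0"
  proof (rule ccontr)
    assume "\<not> ?thesis"
    then have "\<And>x. x \<in> A \<Longrightarrow> f x \<ge> 0" by force
    then show False
      using sum_nonneg_eq_0_iff[OF assms(1), of f] assms by simp
  qed
  show "\<exists>x\<in>A. f x > 0"
  proof (rule ccontr)
    assume "\<not> ?thesis"
    then have "\<And>x. x \<in> A \<Longrightarrow> f x \<le> 0" by force
    then show False
      using sum_nonneg_eq_0_iff[OF assms(1), of "\<lambda>x. - f x"] assms by (simp add: sum_negf)
  qed
qed

text \<open>A successor concentrated at \<open>c\<close> has variance 0. The tied link puts the mean
  of class \<open>r\<close> at \<open>c - 1\<close>, and the comparison of second moments forces
  variance 0 there too, against the split.\<close>

lemma split_class_tied:
  assumes p: "p \<ge> 1" and d: "d \<ge> 1" and S1: "h \<in> S1 p d" and C: "h \<in> C_END p d"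
    and r: "r < p" and tied: "tied p d h r" and split: "split_class p d h r"
  shows "split_class p d h (Suc r mod p)"
proof (rule ccontr)
  let ?r' = "Suc r mod p"
  assume nsplit: "\<not> split_class p d h ?r'"
  have r': "?r' < p"
    using p by simp
  note sum1 = S1_D(3)[OF p d S1]
  obtain c where c: "c \<in> residue_class p d ?r'" "h c \<noteq> 0"
    using sum1[OF r'] unfolding moment_def by (force intro: ccontr)
  then have hc: "h c = 1"
    using ex_other_support[OF sum1[OF r'] c(1)] nsplit unfolding split_class_def by blast
  have moment': "moment p d h 1 k ?r' = (real c - 1) ^ k" for k
  proof -
    have "moment p d h 1 k ?r' = (\<Sum>i\<in>{c}. (real i - 1) ^ k * h i)"
      by (rule moment_restrict) (use c nsplit in \<open>auto simp: split_class_def\<close>)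
    then show ?thesis using hc by simp
  qed
  define m where "m = real c - 1"
  have mean: "moment p d h 0 1 r = m"
    using tied moment'[of 1] by (simp add: tied_def m_def)
  obtain a where a: "a \<in> residue_class p d r" "h a \<noteq> 0" "real a \<noteq> m"
    using split unfolding split_class_def by (metis of_nat_eq_iff)
  have "moment p d h m 1 r = moment p d h 0 1 r - m * moment p d h 0 0 r"
    by (simp add: moment_def sum_distrib_left sum_subtractf algebra_simps)
  then have "(\<Sum>i\<in>residue_class p d r. (real i - m) * h i) = 0"
    using sum1[OF r] mean by (simp add: moment_def)
  \<comment> \<open>The weighted deviations from the mean cancel and one is nonzero, so there are
    support points on both sides of \<open>m\<close>.\<close>
  from sum_eq_0_ex_signs[OF finite_residue_class this a(1)] a(2,3)
  obtain x y where x: "x \<in> residue_class p d r" "(real x - m) * h x < 0" and y: "y \<in> residue_class p d r" "(real y - m) * h y > 0"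
    by auto
  have pos: "h i \<ge> 0" for i
    by (rule S1_D(2)[OF p d S1])
  have "real x < m" "m < real y"
    using x(2) y(2) pos[of x] pos[of y] by (auto simp: mult_less_0_iff zero_less_mult_iff)
  then have xy: "x < c - 1" "c - 1 < y" "Suc (c - 1) = c"
    by (auto simp: m_def)
  txt \<open>Three distinct congruent indices force \<open>d \<ge> 2\<close>, so that the second moments can be compared.\<close>
  have "(c - 1) mod p = r"
    using mod_Suc_cancel[of "c - 1" p r] xy(3) c(1) r by (simp add: residue_class_def)
  then have "d \<ge> 2"
    using x(1) y(1) xy by (intro two_le_if_three_congruent[of x "c - 1" y p d]) (auto simp: residue_class_def)
  then have "moment p d h 0 2 r \<le> m\<^sup>2"
    using C_END_moment_2[OF p _ C r] tied moment'[of 2] by (simp add: tied_def m_def)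
  moreover have "moment p d h m 2 r = moment p d h 0 2 r - 2 * m * moment p d h 0 1 r + m\<^sup>2 * moment p d h 0 0 r"
    by (simp add: moment_def sum_distrib_left sum_subtractf sum.distrib algebra_simps power2_eq_square)
  ultimately have "moment p d h m 2 r \<le> 0"
    using sum1[OF r] mean by (simp add: power2_eq_square)
  moreover have "moment p d h m 2 r \<ge> (real a - m)\<^sup>2 * h a"
    unfolding moment_def using a(1) pos by (intro member_le_sum) auto
  moreover have "(real a - m)\<^sup>2 * h a > 0"
    using a(2,3) pos[of a] by (simp add: zero_less_mult_iff)
  ultimately show False by linarith
qed

text \<open>After shifting class \<open>r + 1\<close> down by 1, both classes have \<open>i\<close>
  as a support point and one further point each. Equal means put the further point of the second
  class nearer to \<open>i\<close>, and its second moment about \<open>i\<close> is then strictly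
  smaller, which \<open>C_END\<close> forbids.\<close>

lemma drop_not_tied:
  assumes p: "p \<ge> 1" and d: "d \<ge> 1" and ext: "h extreme_point_of S1 p d" and C: "h \<in> C_END p d"
    and i: "i + 1 < p * (d + 1)" and drop: "h i > h (i + 1)" and frac: "h i \<noteq> 1" "h (i + 1) \<noteq> 0"
  shows "\<not> tied p d h (i mod p)"
proof
  assume tied: "tied p d h (i mod p)"
  define r where "r = i mod p"
  let ?r' = "Suc r mod p"
  have S1: "h \<in> S1 p d"
    using ext by (simp add: extreme_point_of_def)
  note sum1 = S1_D(3)[OF p d S1]
  have pos: "h j \<ge> 0" for j
    by (rule S1_D(2)[OF p d S1])
  have r: "r < p" "?r' < p"
    using p by (simp_all add: r_def)
  have i1: "i \<in> residue_class p d r" and i2: "Suc i \<in> residue_class p d ?r'"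
    using i by (simp_all add: residue_class_def r_def mod_Suc_eq)
  have "h (Suc i) \<le> moment p d h 0 0 ?r'" "h i \<le> moment p d h 0 0 r"
    unfolding moment_def using i1 i2 pos member_le_sum[of _ _ h] by auto
  then have lt1: "h i < 1" "h (Suc i) < 1"
    using sum1 r frac(1) drop by auto
  obtain b where b: "b \<in> residue_class p d r" "b \<noteq> i" "h b \<noteq> 0"
    using ex_other_support[OF sum1[OF r(1)] i1] lt1 by auto
  obtain b' where b': "b' \<in> residue_class p d ?r'" "b' \<noteq> Suc i" "h b' \<noteq> 0"
    using ex_other_support[OF sum1[OF r(2)] i2] lt1 by auto
  have nz: "h i \<noteq> 0" "h (Suc i) \<noteq> 0"
    using frac(2) drop pos[of "i + 1"] by auto
  have moment: "moment p d h c k r = (real i - c) ^ k * h i + (real b - c) ^ k * h b" for c k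
  proof -
    have "moment p d h c k r = (\<Sum>j\<in>{i, b}. (real j - c) ^ k * h j)"
      using extreme_point_S1_support_le_2[OF p d ext i1 b(1)] i1 b nz by (intro moment_restrict) auto
    then show ?thesis using b(2) by simp
  qed
  have moment': "moment p d h c k ?r' = (real (Suc i) - c) ^ k * h (Suc i) + (real b' - c) ^ k * h b'" for c k
  proof -
    have "moment p d h c k ?r' = (\<Sum>j\<in>{Suc i, b'}. (real j - c) ^ k * h j)"
      using extreme_point_S1_support_le_2[OF p d ext i2 b'(1)] i2 b' nz by (intro moment_restrict) auto
    then show ?thesis using b'(2) by simp
  qed
  \<comment> \<open>Offsets of the other support points from \<open>i\<close>; the 1 subtracted in
    \<open>y\<close> is the shift between consecutive classes.\<close>
  define x where "x = real b - real i"
  define y where "y = real b' - 1 - real i"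
  have hb: "h b = 1 - h i" "h b' = 1 - h (Suc i)"
    using sum1[OF r(1)] sum1[OF r(2)] unfolding moment moment' by simp_all
  have bx: "real b = real i + x" "real b' - 1 = real i + y"
    by (simp_all add: x_def y_def)
  have "(real (Suc i) - 1) * h (Suc i) + (real b' - 1) * h b' = real i * h i + real b * h b"
    using tied unfolding tied_def r_def[symmetric] moment moment' by simp
  then have first: "h b' * y = h b * x"
    unfolding bx by (simp add: hb algebra_simps)
  have hlt: "0 < h b" "h b < h b'"
    using lt1 drop hb by auto
  have x0: "x \<noteq> 0"
    using b(2) by (simp add: x_def)
  define t where "t = h b / h b'"
  have t: "0 < t" "t < 1" "y = t * x"
    using hlt first by (simp_all add: t_def field_simps)
  \<comment> \<open>As \<open>y = t * x\<close> with \<open>t\<close> strictly between 0 and 1, the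
    index \<open>b' - 1\<close> lies strictly between \<open>i\<close> and \<open>b\<close>. These
    three congruent indices yield \<open>d \<ge> 2\<close>.\<close>
  have order: "x < y \<and> y < 0 \<or> 0 < y \<and> y < x"
    using x0 t by (cases "x > 0") (auto simp: mult_less_0_iff)
  have b'pos: "Suc (b' - 1) = b'"
    using order by (cases b') (auto simp: x_def y_def)
  then have ry: "real (b' - 1) = real i + y"
    using bx(2) by (metis of_nat_Suc add_diff_cancel_left' diff_add_cancel)
  have mods: "(b' - 1) mod p = i mod p" "b mod p = i mod p"
    using mod_Suc_cancel[of "b' - 1" p i] b'pos b'(1) b(1) by (simp_all add: residue_class_def r_def mod_Suc_eq)
  have "d \<ge> 2"
  proof (cases "x > 0")
    case True
    then have "i < b' - 1" "b' - 1 < b"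
      using order ry bx by (auto simp flip: of_nat_less_iff[where 'a = real])
    then show ?thesis
      using mods b(1) by (intro two_le_if_three_congruent[of i "b' - 1" b p d]) (auto simp: residue_class_def)
  next
    case False
    then have "b < b' - 1" "b' - 1 < i"
      using order ry bx by (auto simp flip: of_nat_less_iff[where 'a = real])
    then show ?thesis
      using mods i by (intro two_le_if_three_congruent[of b "b' - 1" i p d]) auto
  qed
  from C_END_moment_2[OF p this C r(1) tied[unfolded tied_def r_def[symmetric]]]
  have "(real i)\<^sup>2 * h i + (real b)\<^sup>2 * h b \<le> (real i)\<^sup>2 * h (Suc i) + (real b' - 1)\<^sup>2 * h b'"
    unfolding moment moment' by simp
  \<comment> \<open>Expansion around \<open>i\<close>: the constant terms agree because both class
    sums are 1, the linear ones by \<open>first\<close>.\<close>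
  then have "(real i)\<^sup>2 * (h i + h b) + 2 * real i * (h b * x) + h b * x\<^sup>2
      \<le> (real i)\<^sup>2 * (h (Suc i) + h b') + 2 * real i * (h b' * y) + h b' * y\<^sup>2"
    unfolding bx by (simp add: algebra_simps power2_eq_square)
  then have "h b * x\<^sup>2 \<le> h b' * y\<^sup>2"
    unfolding first using hb by simp
  also have "\<dots> = t * (h b * x\<^sup>2)"
    using first t(3) by (simp add: power2_eq_square algebra_simps)
  also have "\<dots> < 1 * (h b * x\<^sup>2)"
    using t(2) hlt(1) x0 by (intro mult_strict_right_mono) auto
  finally show False by simp
qed

theorem proposition6p3:
  fixes d p :: nat and h :: "nat \<Rightarrow> real"
  assumes "p \<ge> 1"
    and "h extreme_point_of S1 p d"
    and "\<exists>i. i + 1 \<le> p * (d + 1) - 1 \<and> h i > h (i + 1) \<and> h i \<notin> \<int> \<and> h (i + 1) \<notin> \<int>"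
  shows "h \<notin> C_END p d"
proof
  note p = assms(1) and ext = assms(2)
  assume C: "h \<in> C_END p d"
  obtain i where i: "i + 1 \<le> p * (d + 1) - 1" "h i > h (i + 1)" "h i \<notin> \<int>" "h (i + 1) \<notin> \<int>"
    using assms(3) by blast
  have S1: "h \<in> S1 p d"
    using ext by (simp add: extreme_point_of_def)
  have frac: "h i \<noteq> 1" "h (i + 1) \<noteq> 0" "h (i + 1) \<noteq> 1"
    using i(3,4) by auto
  show False
  proof (cases "d = 0")
    \<comment> \<open>For \<open>d = 0\<close> every class is a single index, so equal class sums
      force each entry to be 1. The description of the closure requires
      \<open>d \<ge> 1\<close>.\<close>
    case True
    have "i < p"
      using i(1) True by simp
    then have "residue_class p d i = {i}"
      using True by (auto simp: residue_class_def)
    then have "h i = moment p d h 0 0 i"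
      by (simp add: moment_def)
    also have "\<dots> = moment p d h 0 0 0"
      by (rule C_END_moment_0[OF p C \<open>i < p\<close>])
    also have "\<dots> = 1"
      using S1 unfolding S1_def sum_entry_0[OF p] by blast
    finally show False
      using frac by simp
  next
    case False
    then have d: "d \<ge> 1" by simp
    define r where "r = i mod p"
    let ?r' = "Suc r mod p"
    have r: "r < p" "?r' < p"
      using p by (simp_all add: r_def)
    \<comment> \<open>Positivity rules out truncation in \<open>p * (d + 1) - 1\<close>.\<close>
    have "p * (d + 1) > 0"
      using p by simp
    then have i': "i + 1 < p * (d + 1)"
      using i(1) by linarith
    have ntied: "\<not> tied p d h r"
      unfolding r_def by (rule drop_not_tied[OF p d ext C i' i(2) frac(1,2)])
    have i2: "i + 1 \<in> residue_class p d ?r'"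
      using i' by (simp add: residue_class_def r_def mod_Suc_eq)
    have "split_class p d h ?r'"
      using ex_other_support[OF S1_D(3)[OF p d S1 r(2)] i2 frac(3)] i2 frac(2)
      unfolding split_class_def by blast
    \<comment> \<open>\<open>R\<close> follows tied links forward, and \<open>B\<close> is the block
      of classes reached from the class of \<open>i + 1\<close>.\<close>
    define R where "R = {(s, Suc s mod p) |s. s < p \<and> tied p d h s}"
    define B where "B = {s. (?r', s) \<in> R\<^sup>*}"
    have Suc_inj: "s = t" if "Suc s mod p = Suc t mod p" "s < p" "t < p" for s t
      using mod_Suc_cancel[OF that(1)] that(2,3) by simp
    have "B = {}"
    proof (rule extreme_point_S1_no_split_block[OF p d ext])
      fix s assume s: "s < p" "tied p d h s"
      show "Suc s mod p \<in> B \<longleftrightarrow> s \<in> B"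
      proof
        assume "s \<in> B"
        moreover have "(s, Suc s mod p) \<in> R"
          using s by (auto simp: R_def)
        ultimately show "Suc s mod p \<in> B"
          unfolding B_def by (auto intro: rtrancl_into_rtrancl)
      next
        assume "Suc s mod p \<in> B"
        then have "(?r', Suc s mod p) \<in> R\<^sup>*"
          by (simp add: B_def)
        then show "s \<in> B"
        \<comment> \<open>Backward closure: a tied link into the start of the block would come from
          \<open>r\<close>, whose link is not tied; any other class reached has a unique
          predecessor, already in \<open>B\<close>.\<close>
        proof (cases rule: rtranclE)
          case base
          then have "r = s"
            by (rule Suc_inj[OF _ r(1) s(1)])
          then show ?thesis using ntied s(2) by simp
        next
          case (step t)
          then have "t < p" "Suc s mod p = Suc t mod p"
            by (auto simp: R_def)
          then have "s = t"
            using Suc_inj s(1) by blast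
          then show ?thesis
            using step(1) by (simp add: B_def)
        qed
      qed
    next
      fix s assume "s \<in> B"
      then have "(?r', s) \<in> R\<^sup>*"
        by (simp add: B_def)
      then show "split_class p d h s"
      \<comment> \<open>Being split passes from the class of \<open>i + 1\<close> along tied links
        to the whole block.\<close>
      proof (induction rule: rtrancl_induct)
        case base
        show ?case by fact
      next
        case (step s t)
        then show ?case
          using split_class_tied[OF p d S1 C] by (auto simp: R_def)
      qed
    qed
    then show False
      by (auto simp: B_def)
  qed
qed

end
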